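(* Let $d\ge2$, $\nu>0$, let $\mathcal{S}\subset\{1,\dots,D\}$ be a finite set of $q$ distinct pixel indices, $\tau\in(0,1)$, and let $f(x)=\prod_{u\in\mathcal{S}}\mathbf{1}_{x_u>\tau}$ for $x\in[0,1]^D$. Assume that for all $j\in E_+$, $J_j\cap\mathcal{S}_-=\emptyset$, and let $p=|E_-|$. Then, if there exists $j\in E_-$ such that $J_j\cap\mathcal{S}_-\neq\emptyset$, $\beta^f=0$. Otherwise, for any $j\in E_-$, $$\beta_j^f=c_d^{-1}\left\{\sigma_1\alpha_p+\sigma_2\alpha_p+(p-1)\sigma_3\alpha_p+(d-p)\sigma_3\alpha_{p+1}\right\},$$ and for any $j\in\{1,\dots,d\}\setminus E_-$, $$\beta_j^f=c_d^{-1}\left\{\sigma_1\alpha_p+\sigma_2\alpha_{p+1}+p\,\sigma_3\alpha_p+(d-p-1)\sigma_3\alpha_{p+1}\right\}.$$ (When $p=d$, the term $(d-p)\sigma_3\alpha_{p+1}$ is read as $0$.)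
   Context: Setting (LIME for images). $\xi\in[0,1]^D$ is a fixed (grayscale) image with $D$ pixels. The superpixels $J_1,\dots,J_d$ are non-empty sets forming a partition of $\{1,\dots,D\}$. The replacement image $\bar\xi\in[0,1]^D$ is either constant equal to a given color, or the superpixel mean, $\bar\xi_u=\frac1{|J_k|}\sum_{v\in J_k}\xi_v$ for $u\in J_k$. In both cases $\bar\xi$ is constant on each $J_j$, and this common value is denoted $\bar\xi_j$ when $j$ is a superpixel index. Let $z=(z_1,\dots,z_d)$ be uniform on $\{0,1\}^d$; all expectations are with respect to $z$. The perturbed image $x\in[0,1]^D$ is $x_u=z_j\xi_u+(1-z_j)\bar\xi_u$ for $u\in J_j$. The weight is $\pi=\psi(S/d)$, where $S=\#\{j:z_j=0\}$ and $\psi(t)=\exp\left(\frac{-(1-\sqrt{1-t})^2}{2\nu^2}\right)$ for $t\in[0,1]$. Sets. $E=\{j\in\{1,\dots,d\}: J_j\cap\mathcal{S}\ne\emptyset\}$, $E_+=\{j\in E:\bar\xi_j>\tau\}$, $E_-=\{j\in E:\bar\xi_j\le\tau\}$, $\mathcal{S}_+=\{u\in\mathcal{S}:\xi_u>\tau\}$, $\mathcal{S}_-=\{u\in\mathcal{S}:\xi_u\le\tau\}$. Coefficients. $\alpha_0=\mathbb{E}[\pi]$ and $\alpha_p=\mathbb{E}[\pi z_1\cdots z_p]$ for $1\le p\le d$; $c_d=(d-1)\alpha_0\alpha_2-d\alpha_1^2+\alpha_0\alpha_1$; $\sigma_1=-\alpha_1$; $\sigma_2=\frac{(d-2)\alpha_0\alpha_2-(d-1)\alpha_1^2+\alpha_0\alpha_1}{\alpha_1-\alpha_2}$;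 $\sigma_3=\frac{\alpha_1^2-\alpha_0\alpha_2}{\alpha_1-\alpha_2}$. Limit explanation. Write $\tilde z=(1,z_1,\dots,z_d)^\top\in\mathbb{R}^{d+1}$, $\Sigma=\mathbb{E}[\pi\tilde z\tilde z^\top]$ (an invertible matrix) and $\Gamma^f=\mathbb{E}[\pi f(x)\tilde z]$. Then $\beta^f=\Sigma^{-1}\Gamma^f\in\mathbb{R}^{d+1}$, with coordinates indexed by $0,1,\dots,d$ (coordinate $0$ is the intercept). *)

theory Defs
  imports
    "HOL-Probability.Probability_Mass_Function"
    "Jordan_Normal_Form.Gauss_Jordan_Elimination"
begin

text \<open>
  Pixels are the numbers in \<open>{1..D}\<close>, superpixels are indexed by \<open>{1..d}\<close>, and an image is a
  function \<open>nat \<Rightarrow> real\<close> of which only the values on \<open>{1..D}\<close> matter.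
\<close>

definition is_superpixels :: "nat \<Rightarrow> nat \<Rightarrow> (nat \<Rightarrow> nat set) \<Rightarrow> bool" where
  "is_superpixels D d J \<longleftrightarrow>
     (\<forall>j\<in>{1..d}. J j \<noteq> {}) \<and> disjoint_family_on J {1..d} \<and> (\<Union>j\<in>{1..d}. J j) = {1..D}"

definition is_image :: "nat \<Rightarrow> (nat \<Rightarrow> real) \<Rightarrow> bool" where
  "is_image D \<xi> \<longleftrightarrow> (\<forall>u\<in>{1..D}. 0 \<le> \<xi> u \<and> \<xi> u \<le> 1)"

definition is_replacement ::
  "nat \<Rightarrow> nat \<Rightarrow> (nat \<Rightarrow> nat set) \<Rightarrow> (nat \<Rightarrow> real) \<Rightarrow> (nat \<Rightarrow> real) \<Rightarrow> bool" where
  "is_replacement D d J \<xi> \<xi>b \<longleftrightarrow>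
     (\<exists>c. 0 \<le> c \<and> c \<le> 1 \<and> (\<forall>u\<in>{1..D}. \<xi>b u = c)) \<or>
     (\<forall>k\<in>{1..d}. \<forall>u\<in>J k. \<xi>b u = (\<Sum>v\<in>J k. \<xi> v) / real (card (J k)))"

definition block_value :: "(nat \<Rightarrow> nat set) \<Rightarrow> (nat \<Rightarrow> real) \<Rightarrow> nat \<Rightarrow> real" where
  "block_value J \<xi>b j = (THE a. \<forall>u\<in>J j. \<xi>b u = a)"

definition superpixel_of :: "nat \<Rightarrow> (nat \<Rightarrow> nat set) \<Rightarrow> nat \<Rightarrow> nat" where
  "superpixel_of d J u = (THE j. j \<in> {1..d} \<and> u \<in> J j)"

definition z_distr :: "nat \<Rightarrow> (nat \<Rightarrow> real) pmf" where
  "z_distr d = pmf_of_set ({1..d} \<rightarrow>\<^sub>E {0, 1})"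

definition perturbed ::
  "nat \<Rightarrow> nat \<Rightarrow> (nat \<Rightarrow> nat set) \<Rightarrow> (nat \<Rightarrow> real) \<Rightarrow> (nat \<Rightarrow> real) \<Rightarrow> (nat \<Rightarrow> real) \<Rightarrow> nat \<Rightarrow> real"
where
  "perturbed D d J \<xi> \<xi>b z = (\<lambda>u\<in>{1..D}.
     z (superpixel_of d J u) * \<xi> u + (1 - z (superpixel_of d J u)) * \<xi>b u)"

definition psi :: "real \<Rightarrow> real \<Rightarrow> real" where
  "psi \<nu> t = exp (- ((1 - sqrt (1 - t))\<^sup>2) / (2 * \<nu>\<^sup>2))"

definition lime_weight :: "nat \<Rightarrow> real \<Rightarrow> (nat \<Rightarrow> real) \<Rightarrow> real" where
  "lime_weight d \<nu> z = psi \<nu> (real (card {j\<in>{1..d}. z j = 0}) / real d)"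

text \<open>Only the values \<open>alpha d \<nu> p\<close> with \<open>p \<le> d\<close> are meaningful.\<close>

definition alpha :: "nat \<Rightarrow> real \<Rightarrow> nat \<Rightarrow> real" where
  "alpha d \<nu> p = measure_pmf.expectation (z_distr d) (\<lambda>z. lime_weight d \<nu> z * (\<Prod>i=1..p. z i))"

definition c_coeff :: "nat \<Rightarrow> real \<Rightarrow> real" where
  "c_coeff d \<nu> =
     (real d - 1) * alpha d \<nu> 0 * alpha d \<nu> 2 - real d * (alpha d \<nu> 1)\<^sup>2 + alpha d \<nu> 0 * alpha d \<nu> 1"

definition sigma1 :: "nat \<Rightarrow> real \<Rightarrow> real" where
  "sigma1 d \<nu> = - alpha d \<nu> 1"

definition sigma2 :: "nat \<Rightarrow> real \<Rightarrow> real" where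
  "sigma2 d \<nu> =
     ((real d - 2) * alpha d \<nu> 0 * alpha d \<nu> 2 - (real d - 1) * (alpha d \<nu> 1)\<^sup>2
        + alpha d \<nu> 0 * alpha d \<nu> 1) / (alpha d \<nu> 1 - alpha d \<nu> 2)"

definition sigma3 :: "nat \<Rightarrow> real \<Rightarrow> real" where
  "sigma3 d \<nu> = ((alpha d \<nu> 1)\<^sup>2 - alpha d \<nu> 0 * alpha d \<nu> 2) / (alpha d \<nu> 1 - alpha d \<nu> 2)"

definition z_tilde :: "nat \<Rightarrow> (nat \<Rightarrow> real) \<Rightarrow> real vec" where
  "z_tilde d z = vec (d + 1) (\<lambda>i. if i = 0 then 1 else z i)"

definition Sigma_mat :: "nat \<Rightarrow> real \<Rightarrow> real mat" where
  "Sigma_mat d \<nu> = mat (d + 1) (d + 1) (\<lambda>(i, k).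
     measure_pmf.expectation (z_distr d)
       (\<lambda>z. lime_weight d \<nu> z * (z_tilde d z $ i * z_tilde d z $ k)))"

definition Gamma_vec ::
  "nat \<Rightarrow> nat \<Rightarrow> (nat \<Rightarrow> nat set) \<Rightarrow> (nat \<Rightarrow> real) \<Rightarrow> (nat \<Rightarrow> real) \<Rightarrow> real
     \<Rightarrow> ((nat \<Rightarrow> real) \<Rightarrow> real) \<Rightarrow> real vec" where
  "Gamma_vec D d J \<xi> \<xi>b \<nu> f = vec (d + 1) (\<lambda>i.
     measure_pmf.expectation (z_distr d)
       (\<lambda>z. lime_weight d \<nu> z * f (perturbed D d J \<xi> \<xi>b z) * z_tilde d z $ i))"

text \<open>
  \<open>mat_inverse\<close> returns \<open>None\<close> on singular matrices; \<open>Sigma_mat d \<nu>\<close> is invertible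
  for \<open>d \<ge> 1\<close> and \<open>\<nu> > 0\<close>.
\<close>

definition lime_beta ::
  "nat \<Rightarrow> nat \<Rightarrow> (nat \<Rightarrow> nat set) \<Rightarrow> (nat \<Rightarrow> real) \<Rightarrow> (nat \<Rightarrow> real) \<Rightarrow> real
     \<Rightarrow> ((nat \<Rightarrow> real) \<Rightarrow> real) \<Rightarrow> real vec" where
  "lime_beta D d J \<xi> \<xi>b \<nu> f = the (mat_inverse (Sigma_mat d \<nu>)) *\<^sub>v Gamma_vec D d J \<xi> \<xi>b \<nu> f"

definition shape_model :: "nat set \<Rightarrow> real \<Rightarrow> (nat \<Rightarrow> real) \<Rightarrow> real" where
  "shape_model S \<tau> x = (\<Prod>u\<in>S. of_bool (x u > \<tau>))"

definition E_set :: "nat \<Rightarrow> (nat \<Rightarrow> nat set) \<Rightarrow> nat set \<Rightarrow> nat set" where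
  "E_set d J S = {j\<in>{1..d}. J j \<inter> S \<noteq> {}}"

definition E_plus ::
  "nat \<Rightarrow> (nat \<Rightarrow> nat set) \<Rightarrow> (nat \<Rightarrow> real) \<Rightarrow> nat set \<Rightarrow> real \<Rightarrow> nat set" where
  "E_plus d J \<xi>b S \<tau> = {j\<in>E_set d J S. block_value J \<xi>b j > \<tau>}"

definition E_minus ::
  "nat \<Rightarrow> (nat \<Rightarrow> nat set) \<Rightarrow> (nat \<Rightarrow> real) \<Rightarrow> nat set \<Rightarrow> real \<Rightarrow> nat set" where
  "E_minus d J \<xi>b S \<tau> = {j\<in>E_set d J S. block_value J \<xi>b j \<le> \<tau>}"

definition S_minus :: "(nat \<Rightarrow> real) \<Rightarrow> nat set \<Rightarrow> real \<Rightarrow> nat set" where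
  "S_minus \<xi> S \<tau> = {u\<in>S. \<xi> u \<le> \<tau>}"

end

theory Submission
  imports Defs "Jordan_Normal_Form.Determinant"
begin

unbundle no vec_syntax

text \<open>
  On the cube \<open>{0,1}\<^sup>d\<close> the model \<open>f(x)\<close> is either identically \<open>0\<close> or equals the monomial
  \<open>\<Prod>j\<in>E_-. z\<^sub>j\<close>, and the weight is invariant under permutations of the coordinates, so every
  entry of \<open>\<Sigma>\<close> and \<open>\<Gamma>\<close> is some \<open>\<alpha>\<^sub>k\<close>.  Row \<open>j\<close> of \<open>\<Sigma> \<beta> = \<Gamma>\<close> then involves only \<open>\<beta>\<^sub>0\<close>,
  \<open>\<beta>\<^sub>j\<close> and the sum \<open>\<beta>\<^sub>1 + \<dots> + \<beta>\<^sub>d\<close>, and the system is solved by first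
  summing its rows.  The solution formula also gives injectivity of \<open>\<Sigma>\<close>; it divides by
  \<open>\<alpha>\<^sub>0\<close>, \<open>\<alpha>\<^sub>1 - \<alpha>\<^sub>2 = E[\<pi> z\<^sub>1 (1 - z\<^sub>2)]\<close> and \<open>c\<^sub>d\<close>, where with \<open>N = z\<^sub>1 + \<dots> + z\<^sub>d\<close>
  one has \<open>\<alpha>\<^sub>0 d c\<^sub>d = E[\<pi> (\<alpha>\<^sub>0 N - d \<alpha>\<^sub>1)\<^sup>2]\<close>, the strict Cauchy--Schwarz inequality.
\<close>

section \<open>Weighted expectations over the cube\<close>

definition cube :: "nat \<Rightarrow> (nat \<Rightarrow> real) set" where
  "cube d = {1..d} \<rightarrow>\<^sub>E {0, 1}"

text \<open>Each \<open>alpha\<close> and each entry of \<open>Sigma_mat\<close> and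
  \<open>Gamma_vec\<close> is a value of this functional, so linearity, positivity and symmetry are
  proved once, for it.\<close>

definition wexp :: "nat \<Rightarrow> real \<Rightarrow> ((nat \<Rightarrow> real) \<Rightarrow> real) \<Rightarrow> real" where
  "wexp d \<nu> g = measure_pmf.expectation (z_distr d) (\<lambda>z. lime_weight d \<nu> z * g z)"

lemma finite_cube: "finite (cube d)"
  unfolding cube_def by (intro finite_PiE) auto

lemma cube_nonempty: "cube d \<noteq> {}"
  unfolding cube_def by (simp add: PiE_eq_empty_iff)

lemma cube_cases: "z \<in> cube d \<Longrightarrow> j \<in> {1..d} \<Longrightarrow> z j = 0 \<or> z j = 1"
  using PiE_mem[of z "{1..d}" "\<lambda>_. {0, 1}" j] unfolding cube_def by simp

lemma wexp_sum_cube: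
  "wexp d \<nu> g = (\<Sum>z\<in>cube d. lime_weight d \<nu> z * g z) / real (card (cube d))"
  using integral_pmf_of_set[OF cube_nonempty finite_cube]
  unfolding wexp_def z_distr_def cube_def[symmetric] by simp

lemma wexp_cong:
  assumes "\<And>z. z \<in> cube d \<Longrightarrow> g z = h z"
  shows "wexp d \<nu> g = wexp d \<nu> h"
  unfolding wexp_sum_cube using assms by (simp cong: sum.cong)

lemma wexp_add: "wexp d \<nu> (\<lambda>z. g z + h z) = wexp d \<nu> g + wexp d \<nu> h"
  unfolding wexp_sum_cube by (simp add: distrib_left sum.distrib add_divide_distrib)

lemma wexp_diff: "wexp d \<nu> (\<lambda>z. g z - h z) = wexp d \<nu> g - wexp d \<nu> h"
  unfolding wexp_sum_cube by (simp add: right_diff_distrib sum_subtractf diff_divide_distrib)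

lemma wexp_cmult: "wexp d \<nu> (\<lambda>z. c * g z) = c * wexp d \<nu> g"
  unfolding wexp_sum_cube by (simp add: sum_distrib_left mult.left_commute)

lemma wexp_sum: "wexp d \<nu> (\<lambda>z. \<Sum>i\<in>A. g i z) = (\<Sum>i\<in>A. wexp d \<nu> (g i))"
  unfolding wexp_sum_cube sum_distrib_left sum_divide_distrib by (rule sum.swap)

lemma lime_weight_pos: "0 < lime_weight d \<nu> z"
  by (simp add: lime_weight_def psi_def)

text \<open>All weights are strictly positive, so a single point with \<open>0 < g z0\<close>
  suffices.\<close>

lemma wexp_pos:
  assumes "\<And>z. z \<in> cube d \<Longrightarrow> 0 \<le> g z" and "z0 \<in> cube d" and "0 < g z0"
  shows "0 < wexp d \<nu> g"
proof -
  have "0 < (\<Sum>z\<in>cube d. lime_weight d \<nu> z * g z)"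
    using assms
    by (intro sum_pos2[OF finite_cube, of z0]) (auto simp: lime_weight_pos less_imp_le)
  moreover have "0 < card (cube d)"
    using finite_cube cube_nonempty by (simp add: card_gt_0_iff)
  ultimately show ?thesis
    unfolding wexp_sum_cube by simp
qed

lemma alpha_eq_wexp: "alpha d \<nu> p = wexp d \<nu> (\<lambda>z. \<Prod>i=1..p. z i)"
  unfolding alpha_def wexp_def ..

section \<open>Permutation invariance\<close>

lemma ex_bij_betw_image_eq:
  fixes A :: "nat set"
  assumes "A \<subseteq> {1..d}"
  obtains h where "bij_betw h {1..d} {1..d}" "bij_betw h {1..card A} A"
proof -
  have fin: "finite A" using assms finite_subset by blast
  have le: "card A \<le> d" using card_mono[OF _ assms] by simp
  obtain f where f: "bij_betw f {1..card A} A"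
    using finite_same_card_bij[of "{1..card A}" A] fin by auto
  \<comment> \<open>The complements also have equal size, so the bijection onto \<open>A\<close> can
    be completed to a permutation of all coordinates.\<close>
  have "card ({1..d} - {1..card A}) = card ({1..d} - A)"
    using assms fin le by (simp add: card_Diff_subset)
  then obtain g where g: "bij_betw g ({1..d} - {1..card A}) ({1..d} - A)"
    using finite_same_card_bij[of "{1..d} - {1..card A}" "{1..d} - A"] by auto
  define h where "h i = (if i \<in> {1..card A} then f i else g i)" for i
  have hf: "bij_betw h {1..card A} A"
    using f by (subst bij_betw_cong[of _ h f]) (auto simp: h_def)
  have hg: "bij_betw h ({1..d} - {1..card A}) ({1..d} - A)"
    using g by (subst bij_betw_cong[of _ h g]) (auto simp: h_def)
  have "bij_betw h ({1..card A} \<union> ({1..d} - {1..card A})) (A \<union> ({1..d} - A))"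
    by (rule bij_betw_combine[OF hf hg]) auto
  moreover have "{1..card A} \<union> ({1..d} - {1..card A}) = {1..d}" "A \<union> ({1..d} - A) = {1..d}"
    using le assms by auto
  ultimately show thesis using hf that by metis
qed

text \<open>The weight depends only on the number of zero coordinates. Permuting the coordinates
  therefore preserves it, and a suitable permutation carries \<open>A\<close> to the initial segment
  used in \<open>alpha\<close>.\<close>

lemma wexp_prod:
  assumes A: "A \<subseteq> {1..d}"
  shows "wexp d \<nu> (\<lambda>z. \<Prod>i\<in>A. z i) = alpha d \<nu> (card A)"
proof -
  obtain h where h: "bij_betw h {1..d} {1..d}" and hA: "bij_betw h {1..card A} A"
    using ex_bij_betw_image_eq[OF A] .
  have le: "card A \<le> d" using card_mono[OF _ A] by simp
  define k where "k = the_inv_into {1..d} h"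
  have k: "bij_betw k {1..d} {1..d}" unfolding k_def by (rule bij_betw_the_inv_into[OF h])
  have kh: "k (h i) = i" if "i \<in> {1..d}" for i
    unfolding k_def using h that by (simp add: bij_betw_def the_inv_into_f_f)
  have hk: "h (k i) = i" if "i \<in> {1..d}" for i
    unfolding k_def using h that f_the_inv_into_f_bij_betw by fast
  have hin: "h i \<in> {1..d}" if "i \<in> {1..d}" for i using h that bij_betwE by blast
  have kin: "k i \<in> {1..d}" if "i \<in> {1..d}" for i using k that bij_betwE by blast
  \<comment> \<open>\<open>H\<close> precomposes with \<open>h\<close>, \<open>K\<close> with its
    inverse. Restriction to \<open>{1..d}\<close> keeps the results extensional, so that on the cube
    the inverse laws are equations between whole functions.\<close>
  define H where "H z = (\<lambda>i\<in>{1..d}. z (h i))" for z :: "nat \<Rightarrow> real"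
  define K where "K z = (\<lambda>i\<in>{1..d}. z (k i))" for z :: "nat \<Rightarrow> real"
  have weight: "lime_weight d \<nu> (H z) = lime_weight d \<nu> z" for z
  proof -
    have "bij_betw h {j\<in>{1..d}. z (h j) = 0} {j\<in>{1..d}. z j = 0}"
    proof (rule bij_betw_imageI)
      show "inj_on h {j\<in>{1..d}. z (h j) = 0}"
        using h by (auto simp: bij_betw_def intro: inj_on_subset)
      show "h ` {j\<in>{1..d}. z (h j) = 0} = {j\<in>{1..d}. z j = 0}"
      proof (intro equalityI subsetI)
        fix j assume j: "j \<in> {j\<in>{1..d}. z j = 0}"
        then have "k j \<in> {j\<in>{1..d}. z (h j) = 0}" using kin[of j] hk[of j] by simp
        then show "j \<in> h ` {j\<in>{1..d}. z (h j) = 0}" using hk[of j] j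
          by (metis (lifting) imageI mem_Collect_eq)
      qed (use hin in auto)
    qed
    moreover have "{j\<in>{1..d}. H z j = 0} = {j\<in>{1..d}. z (h j) = 0}" by (auto simp: H_def)
    ultimately show ?thesis
      unfolding lime_weight_def by (simp add: bij_betw_same_card)
  qed
  have monomial: "(\<Prod>i=1..card A. H z i) = (\<Prod>i\<in>A. z i)" for z
  proof -
    have "(\<Prod>i=1..card A. H z i) = (\<Prod>i=1..card A. z (h i))"
      using le by (intro prod.cong) (auto simp: H_def)
    also have "\<dots> = (\<Prod>i\<in>A. z i)" by (rule prod.reindex_bij_betw[OF hA])
    finally show ?thesis .
  qed
  have Hc: "H z \<in> cube d" if "z \<in> cube d" for z
    using cube_cases[OF that hin] unfolding cube_def H_def by auto
  have Kc: "K z \<in> cube d" if "z \<in> cube d" for z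
    using cube_cases[OF that kin] unfolding cube_def K_def by auto
  have HK: "H (K z) = z" if "z \<in> cube d" for z
  proof
    fix i show "H (K z) i = z i"
      using that hin[of i] kh[of i] PiE_arb[of z "{1..d}" "\<lambda>_. {0,1}" i]
      by (cases "i \<in> {1..d}") (auto simp: H_def K_def cube_def)
  qed
  have KH: "K (H z) = z" if "z \<in> cube d" for z
  proof
    fix i show "K (H z) i = z i"
      using that kin[of i] hk[of i] PiE_arb[of z "{1..d}" "\<lambda>_. {0,1}" i]
      by (cases "i \<in> {1..d}") (auto simp: H_def K_def cube_def)
  qed
  have "(\<Sum>z\<in>cube d. lime_weight d \<nu> z * (\<Prod>i\<in>A. z i))
      = (\<Sum>z\<in>cube d. lime_weight d \<nu> z * (\<Prod>i=1..card A. z i))"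
    by (rule sum.reindex_bij_witness[of _ K H]) (simp_all add: HK KH Hc Kc weight monomial del: One_nat_def)
  then show ?thesis
    unfolding alpha_eq_wexp wexp_sum_cube by simp
qed

section \<open>Low-order moments\<close>

lemma wexp_one: "wexp d \<nu> (\<lambda>z. 1) = alpha d \<nu> 0"
  by (simp add: alpha_eq_wexp)

lemma wexp_coord: "j \<in> {1..d} \<Longrightarrow> wexp d \<nu> (\<lambda>z. z j) = alpha d \<nu> 1"
  using wexp_prod[of "{j}" d \<nu>] by simp

lemma wexp_coord_sq:
  assumes "j \<in> {1..d}"
  shows "wexp d \<nu> (\<lambda>z. z j * z j) = alpha d \<nu> 1"
proof -
  have "wexp d \<nu> (\<lambda>z. z j * z j) = wexp d \<nu> (\<lambda>z. z j)"
    by (rule wexp_cong) (use cube_cases[OF _ assms] in auto)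
  then show ?thesis using wexp_coord[OF assms] by simp
qed

lemma wexp_coord_mult:
  assumes "j \<in> {1..d}" "k \<in> {1..d}" "j \<noteq> k"
  shows "wexp d \<nu> (\<lambda>z. z j * z k) = alpha d \<nu> 2"
  using wexp_prod[of "{j, k}" d \<nu>] assms by (simp add: numeral_2_eq_2)

text \<open>Coordinates are idempotent on the cube: a factor already in the monomial is absorbed, a
  new one raises the degree by one.\<close>

lemma wexp_prod_coord:
  assumes A: "A \<subseteq> {1..d}" and j: "j \<in> {1..d}"
  shows "wexp d \<nu> (\<lambda>z. (\<Prod>i\<in>A. z i) * z j)
    = (if j \<in> A then alpha d \<nu> (card A) else alpha d \<nu> (card A + 1))"
proof -
  have fin: "finite A" using A finite_subset by blast
  show ?thesis
  proof (cases "j \<in> A")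
    case True
    have "(\<Prod>i\<in>A. z i) * z j = (\<Prod>i\<in>A. z i)" if "z \<in> cube d" for z
      using cube_cases[OF that j] True fin by auto
    then have "wexp d \<nu> (\<lambda>z. (\<Prod>i\<in>A. z i) * z j) = wexp d \<nu> (\<lambda>z. \<Prod>i\<in>A. z i)"
      by (rule wexp_cong)
    then show ?thesis using True wexp_prod[OF A] by simp
  next
    case False
    then show ?thesis
      using wexp_prod[of "insert j A" d \<nu>] A j fin by (simp add: mult.commute)
  qed
qed

section \<open>Strict inequalities for the denominators\<close>

lemma alpha0_pos: "0 < alpha d \<nu> 0"
proof -
  obtain z where "z \<in> cube d" using cube_nonempty by blast
  then show ?thesis unfolding wexp_one[symmetric] by (intro wexp_pos) auto
qed

lemma alpha1_pos:
  assumes "d \<ge> 1"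
  shows "0 < alpha d \<nu> 1"
proof -
  have j: "1 \<in> {1..d}" using assms by simp
  have "0 \<le> z 1" if "z \<in> cube d" for z
    using cube_cases[OF that j] by auto
  moreover have "(\<lambda>i\<in>{1..d}. 1) \<in> cube d" by (simp add: cube_def)
  ultimately have "0 < wexp d \<nu> (\<lambda>z. z 1)"
    using j by (intro wexp_pos[of d _ "\<lambda>i\<in>{1..d}. 1"]) auto
  then show ?thesis using wexp_coord[OF j] by simp
qed

lemma alpha2_less_alpha1:
  assumes "d \<ge> 2"
  shows "alpha d \<nu> 2 < alpha d \<nu> 1"
proof -
  have j: "1 \<in> {1..d}" "2 \<in> {1..d}" using assms by auto
  \<comment> \<open>A point with first bit 1 and second bit 0, where \<open>z 1 - z 1 * z 2\<close>
    equals 1.\<close>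
  let ?z = "\<lambda>i\<in>{1..d}. if i = 1 then 1 else 0 :: real"
  have "?z \<in> cube d" by (auto simp: cube_def)
  moreover have "0 \<le> z 1 - z 1 * z 2" if "z \<in> cube d" for z
    using cube_cases[OF that j(1)] cube_cases[OF that j(2)] by auto
  ultimately have "0 < wexp d \<nu> (\<lambda>z. z 1 - z 1 * z 2)"
    using j by (intro wexp_pos[of d _ ?z]) auto
  then show ?thesis
    using wexp_coord[OF j(1)] wexp_coord_mult[OF j] by (simp add: wexp_diff)
qed

lemma wexp_sum_coord: "wexp d \<nu> (\<lambda>z. \<Sum>i=1..d. z i) = real d * alpha d \<nu> 1"
proof -
  have "(\<Sum>i=1..d. wexp d \<nu> (\<lambda>z. z i)) = (\<Sum>i=1..d. alpha d \<nu> 1)"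
    by (intro sum.cong refl wexp_coord)
  then show ?thesis by (simp add: wexp_sum)
qed

text \<open>Expanding the square gives \<open>d\<close> diagonal terms, each
  \<open>\<alpha>\<^sub>1\<close> by idempotence, and \<open>d (d - 1)\<close> mixed terms, each
  \<open>\<alpha>\<^sub>2\<close>.\<close>

lemma wexp_sum_coord_sq:
  "wexp d \<nu> (\<lambda>z. (\<Sum>i=1..d. z i)\<^sup>2)
    = real d * (alpha d \<nu> 1 + (real d - 1) * alpha d \<nu> 2)"
proof -
  have "(\<Sum>k=1..d. wexp d \<nu> (\<lambda>z. z j * z k)) = alpha d \<nu> 1 + (real d - 1) * alpha d \<nu> 2"
    if j: "j \<in> {1..d}" for j
  proof -
    have "(\<Sum>k\<in>{1..d}-{j}. wexp d \<nu> (\<lambda>z. z j * z k)) = (\<Sum>k\<in>{1..d}-{j}. alpha d \<nu> 2)"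
      using j by (intro sum.cong) (auto intro!: wexp_coord_mult)
    also have "\<dots> = (real d - 1) * alpha d \<nu> 2"
      using j by (simp add: of_nat_diff)
    finally show ?thesis
      using sum.remove[OF finite_atLeastAtMost j, of "\<lambda>k. wexp d \<nu> (\<lambda>z. z j * z k)"]
        wexp_coord_sq[OF j]
      by simp
  qed
  then have "(\<Sum>j=1..d. \<Sum>k=1..d. wexp d \<nu> (\<lambda>z. z j * z k))
      = (\<Sum>j=1..d. alpha d \<nu> 1 + (real d - 1) * alpha d \<nu> 2)"
    by (intro sum.cong refl)
  then show ?thesis
    by (simp add: power2_eq_square sum_product wexp_sum)
qed

lemma c_coeff_pos:
  assumes d: "d \<ge> 1"
  shows "0 < c_coeff d \<nu>"
proof -
  let ?a0 = "alpha d \<nu> 0" and ?m = "real d * alpha d \<nu> 1"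
  let ?g = "\<lambda>z. (?a0 * (\<Sum>i=1..d. z i) - ?m)\<^sup>2"
  \<comment> \<open>Strictness is witnessed at the origin, where the coordinate sum is 0 and the
    square is \<open>?m\<^sup>2\<close>, positive because
    \<open>\<alpha>\<^sub>1 > 0\<close>.\<close>
  have "(\<lambda>i\<in>{1..d}. 0) \<in> cube d" by (simp add: cube_def)
  moreover have "0 < ?g (\<lambda>i\<in>{1..d}. 0)"
    using alpha1_pos[OF d, of \<nu>] d by simp
  ultimately have "0 < wexp d \<nu> ?g"
    by (intro wexp_pos) auto
  also have "wexp d \<nu> ?g = wexp d \<nu> (\<lambda>z. ?a0\<^sup>2 * (\<Sum>i=1..d. z i)\<^sup>2
      - (2 * ?a0 * ?m) * (\<Sum>i=1..d. z i) + ?m\<^sup>2 * 1)"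
    by (rule wexp_cong) (simp add: power2_eq_square algebra_simps)
  also have "\<dots> = ?a0\<^sup>2 * (real d * (alpha d \<nu> 1 + (real d - 1) * alpha d \<nu> 2))
      - (2 * ?a0 * ?m) * ?m + ?m\<^sup>2 * ?a0"
    by (simp only: wexp_add wexp_diff wexp_cmult wexp_one wexp_sum_coord wexp_sum_coord_sq)
  also have "\<dots> = ?a0 * real d * c_coeff d \<nu>"
    by (simp add: c_coeff_def power2_eq_square algebra_simps)
  finally have "0 < (?a0 * real d) * c_coeff d \<nu>" .
  moreover have "0 < ?a0 * real d" using alpha0_pos[of d \<nu>] d by simp
  ultimately show ?thesis by (rule zero_less_mult_pos)
qed

section \<open>The matrix and its linear system\<close>

lemma Sigma_mat_carrier: "Sigma_mat d \<nu> \<in> carrier_mat (d + 1) (d + 1)"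
  by (simp add: Sigma_mat_def)

text \<open>The index of \<open>\<alpha>\<close> is the number of distinct coordinates in the
  product: the intercept contributes none, and a diagonal entry counts its coordinate once.\<close>

lemma Sigma_mat_index:
  assumes "i \<le> d" "k \<le> d"
  shows "Sigma_mat d \<nu> $$ (i, k) =
    (if i = 0 \<and> k = 0 then alpha d \<nu> 0
     else if i = 0 \<or> k = 0 \<or> i = k then alpha d \<nu> 1 else alpha d \<nu> 2)"
proof -
  have *: "Sigma_mat d \<nu> $$ (i, k)
      = wexp d \<nu> (\<lambda>z. (if i = 0 then 1 else z i) * (if k = 0 then 1 else z k))"
    using assms by (simp add: Sigma_mat_def z_tilde_def wexp_def)
  show ?thesis
    unfolding *
    using assms wexp_one[of d \<nu>] wexp_coord[of i d \<nu>] wexp_coord[of k d \<nu>]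
      wexp_coord_sq[of k d \<nu>] wexp_coord_mult[of i d k \<nu>]
    by auto
qed

lemma Sigma_mult_index:
  assumes b: "b \<in> carrier_vec (d + 1)" and j: "j \<le> d"
  shows "(Sigma_mat d \<nu> *\<^sub>v b) $ j =
    (if j = 0 then alpha d \<nu> 0 * b $ 0 + alpha d \<nu> 1 * (\<Sum>k=1..d. b $ k)
     else alpha d \<nu> 1 * b $ 0 + (alpha d \<nu> 1 - alpha d \<nu> 2) * b $ j
       + alpha d \<nu> 2 * (\<Sum>k=1..d. b $ k))"
proof -
  let ?M = "\<lambda>k. Sigma_mat d \<nu> $$ (j, k)"
  have "(Sigma_mat d \<nu> *\<^sub>v b) $ j = (\<Sum>k\<in>{0..<d+1}. ?M k * b $ k)"
    using b j Sigma_mat_carrier[of d \<nu>] by (auto simp: scalar_prod_def)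
  also have "{0..<d+1} = insert 0 {1..d}" by auto
  also have "(\<Sum>k\<in>insert 0 {1..d}. ?M k * b $ k) = ?M 0 * b $ 0 + (\<Sum>k=1..d. ?M k * b $ k)"
    by simp
  finally have *: "(Sigma_mat d \<nu> *\<^sub>v b) $ j = ?M 0 * b $ 0 + (\<Sum>k=1..d. ?M k * b $ k)" .
  show ?thesis
  proof (cases "j = 0")
    case True
    have "(\<Sum>k=1..d. ?M k * b $ k) = (\<Sum>k=1..d. alpha d \<nu> 1 * b $ k)"
      using True by (intro sum.cong) (auto simp: Sigma_mat_index)
    then show ?thesis using * True by (simp add: Sigma_mat_index sum_distrib_left)
  next
    case False
    then have J: "j \<in> {1..d}" using j by auto
    have "(\<Sum>k\<in>{1..d}-{j}. ?M k * b $ k) = (\<Sum>k\<in>{1..d}-{j}. alpha d \<nu> 2 * b $ k)"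
      using J by (intro sum.cong) (auto simp: Sigma_mat_index)
    then have "(\<Sum>k=1..d. ?M k * b $ k)
        = alpha d \<nu> 1 * b $ j + alpha d \<nu> 2 * (\<Sum>k\<in>{1..d}-{j}. b $ k)"
      using sum.remove[OF finite_atLeastAtMost J, of "\<lambda>k. ?M k * b $ k"] False j
      by (simp add: Sigma_mat_index sum_distrib_left)
    \<comment> \<open>Completing the off-diagonal sum to the full one costs
      \<open>\<alpha>\<^sub>2 b\<^sub>j\<close>, whence the factor
      \<open>\<alpha>\<^sub>1 - \<alpha>\<^sub>2\<close> on \<open>b $ j\<close>.\<close>
    also have "(\<Sum>k\<in>{1..d}-{j}. b $ k) = (\<Sum>k=1..d. b $ k) - b $ j"
      using sum.remove[OF finite_atLeastAtMost J, of "\<lambda>k. b $ k"] by simp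
    finally show ?thesis using * False j
      by (simp add: Sigma_mat_index algebra_simps)
  qed
qed

text \<open>Stated for an arbitrary right-hand side and without inverting the matrix:
  \<open>g = 0\<close> will give injectivity, and \<open>g = \<Gamma>\<close> the coefficients of
  the explanation.\<close>

lemma Sigma_solution:
  fixes b g :: "real vec"
  assumes d: "d \<ge> 2" and b: "b \<in> carrier_vec (d + 1)" and g: "Sigma_mat d \<nu> *\<^sub>v b = g"
  defines "T \<equiv> \<Sum>k=1..d. b $ k" and "G \<equiv> \<Sum>k=1..d. g $ k"
  shows Sigma_solution_sum: "c_coeff d \<nu> * T = alpha d \<nu> 0 * G - real d * alpha d \<nu> 1 * g $ 0"
    and Sigma_solution_0: "alpha d \<nu> 0 * b $ 0 = g $ 0 - alpha d \<nu> 1 * T"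
    and Sigma_solution_coord: "\<And>j. j \<in> {1..d} \<Longrightarrow> b $ j = inverse (c_coeff d \<nu>) *
      (sigma1 d \<nu> * g $ 0 + sigma2 d \<nu> * g $ j + sigma3 d \<nu> * (G - g $ j))"
proof -
  let ?a0 = "alpha d \<nu> 0" and ?a1 = "alpha d \<nu> 1" and ?a2 = "alpha d \<nu> 2" and ?c = "c_coeff d \<nu>"
  have row0: "g $ 0 = ?a0 * b $ 0 + ?a1 * T"
    using Sigma_mult_index[OF b, of 0 \<nu>] g by (simp add: T_def)
  have row: "g $ j = ?a1 * b $ 0 + (?a1 - ?a2) * b $ j + ?a2 * T" if "j \<in> {1..d}" for j
    using Sigma_mult_index[OF b, of j \<nu>] g that by (auto simp: T_def)
  have "G = (\<Sum>j=1..d. ?a1 * b $ 0 + (?a1 - ?a2) * b $ j + ?a2 * T)"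
    unfolding G_def by (intro sum.cong refl row)
  also have "\<dots> = real d * ?a1 * b $ 0 + (?a1 - ?a2) * T + real d * ?a2 * T"
    unfolding T_def by (simp add: sum.distrib sum_distrib_left mult.assoc)
  finally have G: "G = real d * ?a1 * b $ 0 + (?a1 - ?a2) * T + real d * ?a2 * T" .
  \<comment> \<open>Subtracting \<open>d \<alpha>\<^sub>1\<close> times row 0 from
    \<open>\<alpha>\<^sub>0\<close> times the summed rows eliminates \<open>b $ 0\<close>; the
    remaining coefficient of \<open>T\<close> is exactly \<open>c_coeff\<close>.\<close>
  show total: "?c * T = ?a0 * G - real d * ?a1 * g $ 0"
    unfolding G row0 c_coeff_def by (simp add: power2_eq_square algebra_simps)
  show "?a0 * b $ 0 = g $ 0 - ?a1 * T" using row0 by simp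
  fix j assume j: "j \<in> {1..d}"
  have c: "?c \<noteq> 0" using c_coeff_pos[of d \<nu>] d by simp
  have a0: "?a0 \<noteq> 0" using alpha0_pos[of d \<nu>] by simp
  have e: "?a1 - ?a2 \<noteq> 0" using alpha2_less_alpha1[OF d, of \<nu>] by simp
  have s3: "sigma3 d \<nu> * (?a1 - ?a2) = ?a1\<^sup>2 - ?a0 * ?a2"
    using e by (simp add: sigma3_def)
  \<comment> \<open>The numerator of \<open>sigma2\<close> is \<open>c_coeff\<close> plus the
    numerator of \<open>sigma3\<close>.\<close>
  have s2: "sigma2 d \<nu> * (?a1 - ?a2) = ?c + (?a1\<^sup>2 - ?a0 * ?a2)"
  proof -
    have "sigma2 d \<nu> * (?a1 - ?a2)
        = (real d - 2) * ?a0 * ?a2 - (real d - 1) * ?a1\<^sup>2 + ?a0 * ?a1"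
      using e by (simp add: sigma2_def)
    also have "\<dots> = ?c + (?a1\<^sup>2 - ?a0 * ?a2)"
      by (simp add: c_coeff_def algebra_simps)
    finally show ?thesis .
  qed
  \<comment> \<open>The factor \<open>?a1 - ?a2\<close> clears the denominators of
    \<open>sigma2\<close> and \<open>sigma3\<close>; the factor \<open>?a0\<close> allows
    \<open>?a0 * G\<close> to be replaced by means of \<open>total\<close>, after which
    \<open>?c\<close> divides every term.\<close>
  have "?a0 * (?a1 - ?a2) * (sigma1 d \<nu> * g $ 0 + sigma2 d \<nu> * g $ j + sigma3 d \<nu> * (G - g $ j))
      = ?a0 * (?a1 - ?a2) * sigma1 d \<nu> * g $ 0 + ?a0 * (sigma2 d \<nu> * (?a1 - ?a2)) * g $ j
        + ?a0 * (sigma3 d \<nu> * (?a1 - ?a2)) * (G - g $ j)"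
    by (simp add: algebra_simps)
  also have "\<dots> = - ?a0 * (?a1 - ?a2) * ?a1 * g $ 0 + ?a0 * ?c * g $ j
      + (?a1\<^sup>2 - ?a0 * ?a2) * (?a0 * G)"
    unfolding s2 s3 sigma1_def by (simp add: algebra_simps)
  also have "?a0 * G = ?c * T + real d * ?a1 * g $ 0" using total by simp
  also have "- ?a0 * (?a1 - ?a2) * ?a1 * g $ 0 + ?a0 * ?c * g $ j
        + (?a1\<^sup>2 - ?a0 * ?a2) * (?c * T + real d * ?a1 * g $ 0)
      = ?c * (?a0 * g $ j - ?a1 * g $ 0 + (?a1\<^sup>2 - ?a0 * ?a2) * T)"
    by (simp add: c_coeff_def power2_eq_square algebra_simps)
  \<comment> \<open>Row \<open>j\<close> times \<open>?a0\<close> minus row 0 times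
    \<open>?a1\<close> eliminates \<open>b $ 0\<close>, and the terms in \<open>T\<close>
    cancel.\<close>
  also have "\<dots> = ?c * (?a0 * (?a1 - ?a2) * b $ j)"
    unfolding row[OF j] row0 by (simp add: power2_eq_square algebra_simps)
  finally have "?a0 * (?a1 - ?a2) *
      (sigma1 d \<nu> * g $ 0 + sigma2 d \<nu> * g $ j + sigma3 d \<nu> * (G - g $ j))
      = ?a0 * (?a1 - ?a2) * (?c * b $ j)"
    by (simp add: ac_simps)
  then have "sigma1 d \<nu> * g $ 0 + sigma2 d \<nu> * g $ j + sigma3 d \<nu> * (G - g $ j) = ?c * b $ j"
    using a0 e by simp
  then show "b $ j = inverse ?c *
      (sigma1 d \<nu> * g $ 0 + sigma2 d \<nu> * g $ j + sigma3 d \<nu> * (G - g $ j))"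
    using c by simp
qed

text \<open>With zero right-hand side, \<open>c_coeff > 0\<close> forces the coordinate sum to
  vanish, then \<open>\<alpha>\<^sub>0 > 0\<close> forces the intercept to vanish, and the
  coordinate formula gives the rest.\<close>

lemma Sigma_kernel:
  assumes d: "d \<ge> 2" and b: "b \<in> carrier_vec (d + 1)"
    and z: "Sigma_mat d \<nu> *\<^sub>v b = 0\<^sub>v (d + 1)"
  shows "b = 0\<^sub>v (d + 1)"
proof -
  have T: "(\<Sum>k=1..d. b $ k) = 0"
    using Sigma_solution_sum[OF d b z] c_coeff_pos[of d \<nu>] d by simp
  have b0: "b $ 0 = 0"
    using Sigma_solution_0[OF d b z] T alpha0_pos[of d \<nu>] by simp
  have "b $ j = 0" if "j \<in> {1..d}" for j
    using Sigma_solution_coord[OF d b z that] that by simp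
  then have "b $ j = 0" if "j \<le> d" for j
    using that b0 by (cases "j = 0") auto
  then show ?thesis
    using b by (intro eq_vecI) auto
qed

text \<open>This justifies the \<open>the\<close> in \<open>lime_beta\<close>: a trivial kernel
  makes the determinant nonzero, hence the matrix a unit, and then \<open>mat_inverse\<close> cannot
  return \<open>None\<close>.\<close>

lemma Sigma_inverse:
  fixes \<nu> :: real
  assumes d: "d \<ge> 2"
  defines "B \<equiv> the (mat_inverse (Sigma_mat d \<nu>))"
  shows "B \<in> carrier_mat (d + 1) (d + 1)" and "Sigma_mat d \<nu> * B = 1\<^sub>m (d + 1)"
proof -
  let ?M = "Sigma_mat d \<nu>"
  note M = Sigma_mat_carrier[of d \<nu>]
  have "det ?M \<noteq> 0"
    using det_0_iff_vec_prod_zero[OF M] Sigma_kernel[OF d] by blast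
  then have "?M \<in> Units (ring_mat TYPE(real) (d + 1) ())"
    by (rule det_non_zero_imp_unit[OF M])
  then obtain B' where "mat_inverse ?M = Some B'"
    using mat_inverse(1)[OF M, where b = "()"] by (cases "mat_inverse ?M") auto
  then show "B \<in> carrier_mat (d + 1) (d + 1)" "?M * B = 1\<^sub>m (d + 1)"
    using mat_inverse(2)[OF M] unfolding B_def by auto
qed

section \<open>The explanation of an arbitrary model\<close>

lemma Gamma_vec_index:
  assumes "i \<le> d"
  shows "Gamma_vec D d J \<xi> \<xi>b \<nu> f $ i =
    wexp d \<nu> (\<lambda>z. f (perturbed D d J \<xi> \<xi>b z) * (if i = 0 then 1 else z i))"
  using assms by (simp add: Gamma_vec_def z_tilde_def wexp_def mult.assoc)

text \<open>Multiplying \<open>B \<Gamma>\<close> by the matrix returns \<open>\<Gamma>\<close>, so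
  \<open>lime_beta\<close> solves the system and the solution formula applies to it.\<close>

lemma lime_beta_index:
  fixes D d :: nat and J :: "nat \<Rightarrow> nat set" and \<xi> \<xi>b :: "nat \<Rightarrow> real" and \<nu> :: real
    and f :: "(nat \<Rightarrow> real) \<Rightarrow> real"
  assumes d: "d \<ge> 2" and j: "j \<in> {1..d}"
  defines "g \<equiv> Gamma_vec D d J \<xi> \<xi>b \<nu> f"
  shows "lime_beta D d J \<xi> \<xi>b \<nu> f $ j = inverse (c_coeff d \<nu>) *
    (sigma1 d \<nu> * g $ 0 + sigma2 d \<nu> * g $ j + sigma3 d \<nu> * ((\<Sum>k=1..d. g $ k) - g $ j))"
proof -
  note B = Sigma_inverse[OF d, of \<nu>]
  have g: "g \<in> carrier_vec (d + 1)" by (simp add: g_def Gamma_vec_def)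
  have b: "lime_beta D d J \<xi> \<xi>b \<nu> f \<in> carrier_vec (d + 1)"
    unfolding lime_beta_def g_def[symmetric] using B(1) g by simp
  have "Sigma_mat d \<nu> *\<^sub>v lime_beta D d J \<xi> \<xi>b \<nu> f = g"
    unfolding lime_beta_def g_def[symmetric]
    using assoc_mult_mat_vec[OF Sigma_mat_carrier[of d \<nu>] B(1) g] B(2) g by simp
  then show ?thesis by (rule Sigma_solution_coord[OF d b _ j])
qed

section \<open>The shape model on perturbed images\<close>

lemma superpixel_of_eq:
  assumes "is_superpixels D d J" "j \<in> {1..d}" "u \<in> J j"
  shows "superpixel_of d J u = j"
  unfolding superpixel_of_def
  using assms by (intro the_equality) (auto simp: is_superpixels_def disjoint_family_on_def disjoint_iff)

lemma superpixel_obtain: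
  assumes "is_superpixels D d J" "u \<in> {1..D}"
  obtains j where "j \<in> {1..d}" "u \<in> J j"
  using assms unfolding is_superpixels_def by blast

text \<open>Both kinds of replacement are constant on a block, and \<open>u\<close> shows the block
  to be non-empty, so the description by \<open>THE\<close> has a unique solution.\<close>

lemma block_value_eq:
  assumes J: "is_superpixels D d J" and R: "is_replacement D d J \<xi> \<xi>b"
    and j: "j \<in> {1..d}" and u: "u \<in> J j"
  shows "block_value J \<xi>b j = \<xi>b u"
proof -
  have "J j \<subseteq> {1..D}" using J j unfolding is_superpixels_def by blast
  then have "\<exists>a. \<forall>v\<in>J j. \<xi>b v = a"
    using R j unfolding is_replacement_def by blast
  then show ?thesis
    unfolding block_value_def using u by (intro the_equality) auto
qed

lemma perturbed_eq:
  assumes J: "is_superpixels D d J" and j: "j \<in> {1..d}" and u: "u \<in> J j"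
  shows "perturbed D d J \<xi> \<xi>b z u = z j * \<xi> u + (1 - z j) * \<xi>b u"
proof -
  have "u \<in> {1..D}" using J j u unfolding is_superpixels_def by blast
  then show ?thesis by (simp add: perturbed_def superpixel_of_eq[OF assms])
qed

text \<open>Some pixel of \<open>S\<close> is at most \<open>\<tau>\<close> both in the image and in
  its replacement, so its factor vanishes for either value of the bit.\<close>

lemma shape_model_perturbed_zero:
  assumes J: "is_superpixels D d J" and R: "is_replacement D d J \<xi> \<xi>b" and S: "S \<subseteq> {1..D}"
    and j: "j \<in> E_minus d J \<xi>b S \<tau>" and ne: "J j \<inter> S_minus \<xi> S \<tau> \<noteq> {}" and z: "z \<in> cube d"
  shows "shape_model S \<tau> (perturbed D d J \<xi> \<xi>b z) = 0"
proof -
  obtain u where u: "u \<in> J j" "u \<in> S" "\<xi> u \<le> \<tau>"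
    using ne by (auto simp: S_minus_def)
  have jd: "j \<in> {1..d}" and bv: "block_value J \<xi>b j \<le> \<tau>"
    using j by (auto simp: E_minus_def E_set_def)
  have "\<xi>b u \<le> \<tau>" using bv block_value_eq[OF J R jd u(1)] by simp
  then have "\<not> perturbed D d J \<xi> \<xi>b z u > \<tau>"
    using cube_cases[OF z jd] u(3) by (auto simp: perturbed_eq[OF J jd u(1)])
  moreover have "finite S" using S finite_subset by blast
  ultimately show ?thesis
    using u(2) unfolding shape_model_def by (intro prod_zero) auto
qed

text \<open>Switching off a superpixel of \<open>E_minus\<close> exposes a replacement value at most
  \<open>\<tau>\<close> on a pixel of \<open>S\<close>. If none is switched off, every pixel of
  \<open>S\<close> passes the threshold.\<close>

lemma shape_model_perturbed_monomial:
  assumes J: "is_superpixels D d J" and R: "is_replacement D d J \<xi> \<xi>b" and S: "S \<subseteq> {1..D}"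
    and plus: "\<forall>j\<in>E_plus d J \<xi>b S \<tau>. J j \<inter> S_minus \<xi> S \<tau> = {}"
    and minus: "\<forall>j\<in>E_minus d J \<xi>b S \<tau>. J j \<inter> S_minus \<xi> S \<tau> = {}"
    and z: "z \<in> cube d"
  shows "shape_model S \<tau> (perturbed D d J \<xi> \<xi>b z) = (\<Prod>j\<in>E_minus d J \<xi>b S \<tau>. z j)"
proof (cases "\<exists>j\<in>E_minus d J \<xi>b S \<tau>. z j = 0")
  case True
  then obtain j where j: "j \<in> E_minus d J \<xi>b S \<tau>" and zj: "z j = 0" by blast
  then obtain u where u: "u \<in> J j" "u \<in> S" and jd: "j \<in> {1..d}"
    and bv: "block_value J \<xi>b j \<le> \<tau>"
    by (auto simp: E_minus_def E_set_def)
  have "\<not> perturbed D d J \<xi> \<xi>b z u > \<tau>"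
    using bv block_value_eq[OF J R jd u(1)] zj by (simp add: perturbed_eq[OF J jd u(1)])
  moreover have "finite S" using S finite_subset by blast
  ultimately have "shape_model S \<tau> (perturbed D d J \<xi> \<xi>b z) = 0"
    using u(2) unfolding shape_model_def by (intro prod_zero) auto
  moreover have "finite (E_minus d J \<xi>b S \<tau>)" by (simp add: E_minus_def E_set_def)
  then have "(\<Prod>j\<in>E_minus d J \<xi>b S \<tau>. z j) = 0"
    using j zj by (intro prod_zero) auto
  ultimately show ?thesis by simp
next
  case False
  have "perturbed D d J \<xi> \<xi>b z u > \<tau>" if u: "u \<in> S" for u
  proof -
    obtain j where jd: "j \<in> {1..d}" and uj: "u \<in> J j"
      using superpixel_obtain[OF J] u S by blast
    then have jE: "j \<in> E_set d J S" using u by (auto simp: E_set_def)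
    \<comment> \<open>A block meeting \<open>S\<close> lies in \<open>E_plus\<close> or
      \<open>E_minus\<close>, so the two assumptions together leave no pixel of \<open>S\<close> at
      or below \<open>\<tau>\<close> in the original image.\<close>
    then have "J j \<inter> S_minus \<xi> S \<tau> = {}"
      using plus minus by (cases "\<tau> < block_value J \<xi>b j") (simp_all add: E_plus_def E_minus_def)
    then have "\<xi> u > \<tau>" using uj u by (auto simp: S_minus_def)
    \<comment> \<open>A block switched off here is outside \<open>E_minus\<close>; since it meets
      \<open>S\<close>, its replacement value exceeds \<open>\<tau>\<close>.\<close>
    moreover have "z j = 1 \<or> z j = 0 \<and> \<xi>b u > \<tau>"
      using False jE cube_cases[OF z jd] block_value_eq[OF J R jd uj]
      by (auto simp: E_minus_def not_le)
    ultimately show ?thesis by (auto simp: perturbed_eq[OF J jd uj])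
  qed
  then have "shape_model S \<tau> (perturbed D d J \<xi> \<xi>b z) = 1"
    unfolding shape_model_def by (intro prod.neutral) auto
  moreover have "(\<Prod>j\<in>E_minus d J \<xi>b S \<tau>. z j) = 1"
    using False cube_cases[OF z] by (intro prod.neutral) (auto simp: E_minus_def E_set_def)
  ultimately show ?thesis by simp
qed

section \<open>Coefficients for the shape model\<close>

theorem proposition3:
  fixes D d q p :: nat
    and J :: "nat \<Rightarrow> nat set"
    and \<xi> \<xi>b :: "nat \<Rightarrow> real"
    and \<nu> \<tau> :: real
    and S :: "nat set"
  assumes "d \<ge> 2" and "\<nu> > 0"
    and "is_superpixels D d J"
    and "is_image D \<xi>"
    and "is_replacement D d J \<xi> \<xi>b"
    and "S \<subseteq> {1..D}" and "card S = q"
    and "0 < \<tau>" and "\<tau> < 1"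
    and "\<forall>j\<in>E_plus d J \<xi>b S \<tau>. J j \<inter> S_minus \<xi> S \<tau> = {}"
    and "p = card (E_minus d J \<xi>b S \<tau>)"
  shows "if \<exists>j\<in>E_minus d J \<xi>b S \<tau>. J j \<inter> S_minus \<xi> S \<tau> \<noteq> {}
     then lime_beta D d J \<xi> \<xi>b \<nu> (shape_model S \<tau>) = 0\<^sub>v (d + 1)
     else
       (\<forall>j\<in>E_minus d J \<xi>b S \<tau>.
          lime_beta D d J \<xi> \<xi>b \<nu> (shape_model S \<tau>) $ j =
            inverse (c_coeff d \<nu>) *
              (sigma1 d \<nu> * alpha d \<nu> p + sigma2 d \<nu> * alpha d \<nu> p
               + (real p - 1) * sigma3 d \<nu> * alpha d \<nu> p
               + (real d - real p) * sigma3 d \<nu> * alpha d \<nu> (p + 1))) \<and>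
       (\<forall>j\<in>{1..d} - E_minus d J \<xi>b S \<tau>.
          lime_beta D d J \<xi> \<xi>b \<nu> (shape_model S \<tau>) $ j =
            inverse (c_coeff d \<nu>) *
              (sigma1 d \<nu> * alpha d \<nu> p + sigma2 d \<nu> * alpha d \<nu> (p + 1)
               + real p * sigma3 d \<nu> * alpha d \<nu> p
               + (real d - real p - 1) * sigma3 d \<nu> * alpha d \<nu> (p + 1)))"
proof (split if_split, intro conjI impI)
  let ?E = "E_minus d J \<xi>b S \<tau>"
  let ?g = "Gamma_vec D d J \<xi> \<xi>b \<nu> (shape_model S \<tau>)"
  assume "\<exists>j\<in>?E. J j \<inter> S_minus \<xi> S \<tau> \<noteq> {}"
  then obtain j where j: "j \<in> ?E" "J j \<inter> S_minus \<xi> S \<tau> \<noteq> {}" by blast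
  have "?g $ i = 0" if "i \<le> d" for i
    unfolding Gamma_vec_index[OF that] wexp_sum_cube
    by (simp add: shape_model_perturbed_zero[OF assms(3,5,6) j])
  then have "?g = 0\<^sub>v (d + 1)"
    by (intro eq_vecI) (auto simp: Gamma_vec_def)
  then show "lime_beta D d J \<xi> \<xi>b \<nu> (shape_model S \<tau>) = 0\<^sub>v (d + 1)"
    unfolding lime_beta_def using Sigma_inverse(1)[OF assms(1), of \<nu>]
    by (intro eq_vecI) (auto simp: scalar_prod_def)
next
  let ?E = "E_minus d J \<xi>b S \<tau>"
  let ?g = "Gamma_vec D d J \<xi> \<xi>b \<nu> (shape_model S \<tau>)"
  assume "\<not> (\<exists>j\<in>?E. J j \<inter> S_minus \<xi> S \<tau> \<noteq> {})"
  then have minus: "\<forall>j\<in>?E. J j \<inter> S_minus \<xi> S \<tau> = {}" by blast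
  have E: "?E \<subseteq> {1..d}" by (auto simp: E_minus_def E_set_def)
  then have finE: "finite ?E" using finite_subset by blast
  have ple: "p \<le> d" using card_mono[OF _ E] assms(11) by simp
  note monomial = shape_model_perturbed_monomial[OF assms(3,5,6,10) minus]
  have g: "?g $ i = wexp d \<nu> (\<lambda>z. (\<Prod>j\<in>?E. z j) * (if i = 0 then 1 else z i))"
    if "i \<le> d" for i
    unfolding Gamma_vec_index[OF that] by (rule wexp_cong) (simp add: monomial)
  have g0: "?g $ 0 = alpha d \<nu> p"
    using g[of 0] wexp_prod[OF E, of \<nu>] assms(11) by simp
  have gj: "?g $ j = (if j \<in> ?E then alpha d \<nu> p else alpha d \<nu> (p + 1))" if "j \<in> {1..d}" for j
    using g[of j] wexp_prod_coord[OF E that, of \<nu>] assms(11) that by auto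
  \<comment> \<open>The sum has \<open>p\<close> entries \<open>\<alpha>\<^sub>p\<close> and
    \<open>d - p\<close> entries \<open>\<alpha>\<^sub>p\<^sub>+\<^sub>1\<close>. For
    \<open>p = d\<close> the latter are absent, and the value \<open>alpha d \<nu> (d + 1)\<close>,
    outside the meaningful range, is multiplied by 0.\<close>
  have "(\<Sum>k=1..d. ?g $ k) = (\<Sum>k\<in>{1..d}-?E. ?g $ k) + (\<Sum>k\<in>?E. ?g $ k)"
    by (rule sum.subset_diff[OF E]) simp
  also have "(\<Sum>k\<in>?E. ?g $ k) = (\<Sum>k\<in>?E. alpha d \<nu> p)"
    using E by (intro sum.cong) (auto simp: gj subset_iff)
  also have "(\<Sum>k\<in>{1..d}-?E. ?g $ k) = (\<Sum>k\<in>{1..d}-?E. alpha d \<nu> (p + 1))"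
    by (intro sum.cong) (auto simp: gj)
  finally have G: "(\<Sum>k=1..d. ?g $ k) = (real d - real p) * alpha d \<nu> (p + 1) + real p * alpha d \<nu> p"
    using finE E ple assms(11) by (simp add: card_Diff_subset of_nat_diff)
  note beta = lime_beta_index[OF assms(1), of _ D J \<xi> \<xi>b \<nu> "shape_model S \<tau>", unfolded G g0]
  \<comment> \<open>Removing the entry \<open>?g $ j\<close> from the total lowers the count of
    \<open>\<alpha>\<^sub>p\<close> to \<open>p - 1\<close> here; for \<open>j\<close> outside
    \<open>?E\<close> it lowers the count of \<open>\<alpha>\<^sub>p\<^sub>+\<^sub>1\<close> to
    \<open>d - p - 1\<close>.\<close>
  show "\<forall>j\<in>?E. lime_beta D d J \<xi> \<xi>b \<nu> (shape_model S \<tau>) $ j =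
      inverse (c_coeff d \<nu>) *
        (sigma1 d \<nu> * alpha d \<nu> p + sigma2 d \<nu> * alpha d \<nu> p
         + (real p - 1) * sigma3 d \<nu> * alpha d \<nu> p
         + (real d - real p) * sigma3 d \<nu> * alpha d \<nu> (p + 1))"
    using E by (auto simp: beta gj subset_iff algebra_simps)
  show "\<forall>j\<in>{1..d} - ?E. lime_beta D d J \<xi> \<xi>b \<nu> (shape_model S \<tau>) $ j =
      inverse (c_coeff d \<nu>) *
        (sigma1 d \<nu> * alpha d \<nu> p + sigma2 d \<nu> * alpha d \<nu> (p + 1)
         + real p * sigma3 d \<nu> * alpha d \<nu> p
         + (real d - real p - 1) * sigma3 d \<nu> * alpha d \<nu> (p + 1))"
    by (auto simp: beta gj algebra_simps)
qed

end
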